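(* Let $(\mathcal{P})$ be the mixed-integer nonlinear program and $(\overline{\mathcal{P}})$ the mixed-integer program defined in the context. Then $(\overline{\mathcal{P}})$ is a relaxation of $(\mathcal{P})$; that is, every $(\boldsymbol{x},\boldsymbol{y},\boldsymbol{\xi},\boldsymbol{\lambda})$ (with the associated $\widetilde f_0,\dots,\widetilde f_m$) that is feasible for $(\mathcal{P})$ is feasible for $(\overline{\mathcal{P}})$, with the same objective value.
   Context: **Data.** Let $n\ge 1$, $m,p\ge 0$ be integers and let $X\subseteq\mathbb{R}^n$. For each $j=1,\dots,n$ let $\mathcal{B}_j=\{\hat x_j^k\}_{k\in\mathcal{I}_j}\subset\mathbb{R}$ be a finite set of breakpoints with index set $\mathcal{I}_j=\{0,1,\dots,K_j\}$ and $\hat x_j^0<\hat x_j^1<\cdots<\hat x_j^{K_j}$. Put $\mathcal{B}=\mathcal{B}_1\times\cdots\times\mathcal{B}_n\subseteq X$, $\mathcal{I}=\mathcal{I}_1\times\cdots\times\mathcal{I}_n$, and $\hat{\boldsymbol{x}}^{\boldsymbol{k}}=(\hat x_1^{k_1},\dots,\hat x_n^{k_n})$ for $\boldsymbol{k}=(k_1,\dots,k_n)\in\mathcal{I}$. For $i=0,\dots,m$ the real values $f_i(\hat{\boldsymbol{x}}^{\boldsymbol{k}})$, $\boldsymbol{k}\in\mathcal{I}$, are given (look-up tables). Also given are vectors $\boldsymbol{c},\boldsymbol{a}_1,\dots,\boldsymbol{a}_m\in\mathbb{R}^p$ and scalars $b_1,\dots,b_m\in\mathbb{R}$. **SOS2.**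 A vector $\boldsymbol{v}\in\mathbb{R}^{\mathcal{I}_j}$ satisfies $\boldsymbol{v}\in\mathrm{SOS2}(\mathcal{I}_j)$ if at most two of its entries are nonzero and, if two entries are nonzero, their indices are consecutive in $\mathcal{I}_j$. **Problem $(\mathcal{P})$.** Minimize $\widetilde f_0+\boldsymbol{c}^T\boldsymbol{y}$, with $\boldsymbol{\xi}=(\boldsymbol{\xi}^1,\dots,\boldsymbol{\xi}^n)$, $\boldsymbol{\xi}^j\in\mathbb{R}^{\mathcal{I}_j}$, subject to - $\widetilde f_i+\boldsymbol{a}_i^T\boldsymbol{y}\le b_i$ for $i=1,\dots,m$; - $\widetilde f_i=\sum_{\boldsymbol{k}\in\mathcal{I}}\lambda_{\boldsymbol{k}}f_i(\hat{\boldsymbol{x}}^{\boldsymbol{k}})$ for $i=0,\dots,m$; - $\lambda_{\boldsymbol{k}}=\prod_{j=1}^n\xi^j_{k_j}$ for all $\boldsymbol{k}\in\mathcal{I}$; - $x_j=\sum_{k\in\mathcal{I}_j}\xi^j_k\hat x_j^k$ and $\sum_{k\in\mathcal{I}_j}\xi^j_k=1$ for $j=1,\dots,n$; - $\boldsymbol{\xi}^j\in\mathrm{SOS2}(\mathcal{I}_j)$ and $\boldsymbol{\xi}^j\ge\boldsymbol{0}$ for $j=1,\dots,n$; - $\boldsymbol{x}\in X$, $\boldsymbol{y}\in\{0,1\}^p$. **Problem $(\overline{\mathcal{P}})$.** Minimize $\widetilde f_0+\boldsymbol{c}^T\boldsymbol{y}$ subject to - $\widetilde f_i+\boldsymbol{a}_i^T\boldsymbol{y}\le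 b_i$ for $i=1,\dots,m$; - $\widetilde f_i=\sum_{\boldsymbol{k}\in\mathcal{I}}\lambda_{\boldsymbol{k}}f_i(\hat{\boldsymbol{x}}^{\boldsymbol{k}})$ for $i=0,\dots,m$; - $\xi^j_{\hat k}=\sum_{\boldsymbol{k}\in\mathcal{I}:\,k_j=\hat k}\lambda_{\boldsymbol{k}}$ for all $\hat k\in\mathcal{I}_j$ and $j=1,\dots,n$; - $x_j=\sum_{k\in\mathcal{I}_j}\xi^j_k\hat x_j^k$ and $\sum_{k\in\mathcal{I}_j}\xi^j_k=1$ for $j=1,\dots,n$; - $\boldsymbol{\xi}^j\in\mathrm{SOS2}(\mathcal{I}_j)$ for $j=1,\dots,n$; - $\boldsymbol{\lambda}\in[0,1]^{\mathcal{I}}$, $\boldsymbol{x}\in X$, $\boldsymbol{y}\in\{0,1\}^p$. *)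

theory Defs
  imports "HOL-Analysis.Analysis"
begin

text \<open>
  Conventions. The continuous variables live in \<open>real ^ 'n\<close> with \<open>CARD('n) = n \<ge> 1\<close>. All other finite
  index sets (which may be empty or depend on the data) are explicit sets, and a vector of
  $\mathbb{R}^S$ for such an index set \<open>S\<close> is an extensional function on \<open>S\<close>, so that distinct
  elements of the feasible sets below are distinct points of the mathematical problem.
\<close>

record 'a min_problem =
  feasible :: "'a set"
  objective :: "'a \<Rightarrow> real"

definition is_relaxation_of :: "'a min_problem \<Rightarrow> 'a min_problem \<Rightarrow> bool" where
  "is_relaxation_of R P \<longleftrightarrow>
     (\<forall>z \<in> feasible P. z \<in> feasible R \<and> objective R z = objective P z)"

definition SOS2 :: "nat \<Rightarrow> (nat \<Rightarrow> real) set" where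
  "SOS2 K = {v \<in> extensional {0..K}.
     card {k \<in> {0..K}. v k \<noteq> 0} \<le> 2 \<and>
     (\<forall>k \<in> {0..K}. \<forall>l \<in> {0..K}. k < l \<and> v k \<noteq> 0 \<and> v l \<noteq> 0 \<longrightarrow> l = Suc k)}"

text \<open>
  Only the following values matter: \<open>dat_bp D j k\<close> for \<open>k \<le> dat_K D j\<close>, the functions \<open>dat_f D i\<close>
  (\<open>i \<le> m\<close>) at the grid points, \<open>dat_a D i\<close> and \<open>dat_b D i\<close> for \<open>1 \<le> i \<le> m\<close>, and the entries of
  \<open>dat_c D\<close> and \<open>dat_a D i\<close> with index in \<open>{1..p}\<close>.
\<close>

record 'n lut_data =
  dat_m :: nat
  dat_p :: nat
  dat_X :: "(real ^ 'n) set"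
  dat_K :: "'n \<Rightarrow> nat"
  dat_bp :: "'n \<Rightarrow> nat \<Rightarrow> real"
  dat_f :: "nat \<Rightarrow> real ^ 'n \<Rightarrow> real"
  dat_c :: "nat \<Rightarrow> real"
  dat_a :: "nat \<Rightarrow> nat \<Rightarrow> real"
  dat_b :: "nat \<Rightarrow> real"

definition index_set :: "'n::finite lut_data \<Rightarrow> 'n \<Rightarrow> nat set" where
  "index_set D j = {0..dat_K D j}"

definition multi_index_set :: "'n::finite lut_data \<Rightarrow> ('n \<Rightarrow> nat) set" where
  "multi_index_set D = (\<Pi>\<^sub>E j\<in>UNIV. index_set D j)"

definition grid_point :: "'n::finite lut_data \<Rightarrow> ('n \<Rightarrow> nat) \<Rightarrow> real ^ 'n" where
  "grid_point D k = (\<chi> j. dat_bp D j (k j))"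

definition valid_lut_data :: "'n::finite lut_data \<Rightarrow> bool" where
  "valid_lut_data D \<longleftrightarrow>
     (\<forall>j. strict_mono_on (index_set D j) (dat_bp D j)) \<and>
     grid_point D ` multi_index_set D \<subseteq> dat_X D"

text \<open>A candidate solution is a tuple $(x, y, \xi, \lambda, \widetilde f)$.\<close>

type_synonym 'n candidate =
  "(real ^ 'n) \<times> (nat \<Rightarrow> real) \<times> ('n \<Rightarrow> nat \<Rightarrow> real) \<times> (('n \<Rightarrow> nat) \<Rightarrow> real) \<times> (nat \<Rightarrow> real)"

definition lut_objective :: "'n::finite lut_data \<Rightarrow> 'n candidate \<Rightarrow> real" where
  "lut_objective D = (\<lambda>(x, y, \<xi>, lam, ft). ft 0 + (\<Sum>l\<in>{1..dat_p D}. dat_c D l * y l))"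

definition problem_P :: "'n::finite lut_data \<Rightarrow> 'n candidate min_problem" where
  "problem_P D = \<lparr>
     feasible = {(x, y, \<xi>, lam, ft).
       ft \<in> extensional {0..dat_m D} \<and>
       lam \<in> extensional (multi_index_set D) \<and>
       (\<forall>i\<in>{1..dat_m D}. ft i + (\<Sum>l\<in>{1..dat_p D}. dat_a D i l * y l) \<le> dat_b D i) \<and>
       (\<forall>i\<in>{0..dat_m D}. ft i = (\<Sum>k\<in>multi_index_set D. lam k * dat_f D i (grid_point D k))) \<and>
       (\<forall>k\<in>multi_index_set D. lam k = (\<Prod>j\<in>UNIV. \<xi> j (k j))) \<and>
       (\<forall>j. x $ j = (\<Sum>k\<in>index_set D j. \<xi> j k * dat_bp D j k)) \<and>
       (\<forall>j. (\<Sum>k\<in>index_set D j. \<xi> j k) = 1) \<and>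
       (\<forall>j. \<xi> j \<in> SOS2 (dat_K D j)) \<and>
       (\<forall>j. \<forall>k\<in>index_set D j. 0 \<le> \<xi> j k) \<and>
       x \<in> dat_X D \<and>
       y \<in> {1..dat_p D} \<rightarrow>\<^sub>E {0, 1}},
     objective = lut_objective D\<rparr>"

definition problem_Pbar :: "'n::finite lut_data \<Rightarrow> 'n candidate min_problem" where
  "problem_Pbar D = \<lparr>
     feasible = {(x, y, \<xi>, lam, ft).
       ft \<in> extensional {0..dat_m D} \<and>
       (\<forall>i\<in>{1..dat_m D}. ft i + (\<Sum>l\<in>{1..dat_p D}. dat_a D i l * y l) \<le> dat_b D i) \<and>
       (\<forall>i\<in>{0..dat_m D}. ft i = (\<Sum>k\<in>multi_index_set D. lam k * dat_f D i (grid_point D k))) \<and>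
       (\<forall>j. \<forall>h\<in>index_set D j. \<xi> j h = (\<Sum>k\<in>{k \<in> multi_index_set D. k j = h}. lam k)) \<and>
       (\<forall>j. x $ j = (\<Sum>k\<in>index_set D j. \<xi> j k * dat_bp D j k)) \<and>
       (\<forall>j. (\<Sum>k\<in>index_set D j. \<xi> j k) = 1) \<and>
       (\<forall>j. \<xi> j \<in> SOS2 (dat_K D j)) \<and>
       lam \<in> multi_index_set D \<rightarrow>\<^sub>E {0..1} \<and>
       x \<in> dat_X D \<and>
       y \<in> {1..dat_p D} \<rightarrow>\<^sub>E {0, 1}},
     objective = lut_objective D\<rparr>"

end

theory Submission
  imports Defs
begin

text \<open>
  Each weight vector \<open>\<xi> j\<close> is a probability distribution on the breakpoints of coordinate \<open>j\<close>.
  In the nonlinear program, \<open>lam\<close> is the product distribution on the grid. The linear constraints that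
  replace the product in the relaxation say that \<open>lam\<close> has the \<open>\<xi> j\<close> as its marginals and takes values
  in the unit interval. The first holds because every product of probability distributions has its
  factors as marginals (lemma \<open>marginal_of_product_weights\<close>). The second holds because each \<open>\<xi> j\<close> is
  nonnegative with total mass one, so that \<open>lam k\<close> is a product of numbers in the unit interval.
  The other constraints of the relaxation, and the objective, are shared with the nonlinear program.
\<close>

text \<open>
  Fixing the coordinate \<open>j\<close> of a point of a finite box leaves a box whose \<open>j\<close>-th side is a singleton.
  By distributivity the sum over it is the product over the coordinates of one-dimensional sums, of
  which the \<open>j\<close>-th is \<open>w j h\<close> and all others are \<open>1\<close>.
\<close>

lemma marginal_of_product_weights:
  fixes w :: "'i \<Rightarrow> 'a \<Rightarrow> 'b::comm_semiring_1"
  assumes "finite A" and "j \<in> A" and "h \<in> I j"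
    and finite_sides: "\<And>i. i \<in> A \<Longrightarrow> finite (I i)"
    and total: "\<And>i. i \<in> A \<Longrightarrow> i \<noteq> j \<Longrightarrow> (\<Sum>k\<in>I i. w i k) = 1"
  shows "(\<Sum>k\<in>{k \<in> Pi\<^sub>E A I. k j = h}. \<Prod>i\<in>A. w i (k i)) = w j h"
proof -
  have slice: "{k \<in> Pi\<^sub>E A I. k j = h} = Pi\<^sub>E A (I(j := {h}))"
    using \<open>j \<in> A\<close> \<open>h \<in> I j\<close> by (auto simp: PiE_iff extensional_def split: if_splits)
  have "(\<Sum>k\<in>{k \<in> Pi\<^sub>E A I. k j = h}. \<Prod>i\<in>A. w i (k i)) = (\<Prod>i\<in>A. \<Sum>k\<in>(I(j := {h})) i. w i k)"
    unfolding slice using \<open>finite A\<close> finite_sides by (subst prod_sum_PiE) auto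
  also have "\<dots> = (\<Prod>i\<in>A. if i = j then w j h else 1)"
    using total by (intro prod.cong) auto
  also have "\<dots> = w j h"
    using \<open>finite A\<close> \<open>j \<in> A\<close> by (simp add: prod.delta)
  finally show ?thesis .
qed

theorem proposition1:
  fixes D :: "'n::finite lut_data"
  assumes "valid_lut_data D"
  shows "is_relaxation_of (problem_Pbar D) (problem_P D)"
proof -
  have "z \<in> feasible (problem_Pbar D)" if "z \<in> feasible (problem_P D)" for z
  proof -
    obtain x y \<xi> lam ft where z: "z = (x, y, \<xi>, lam, ft)"
      by (metis surj_pair)
    have feas: "(x, y, \<xi>, lam, ft) \<in> feasible (problem_P D)"
      using that z by simp
    have lam_ext: "lam \<in> extensional (multi_index_set D)"
      and lam: "\<And>k. k \<in> multi_index_set D \<Longrightarrow> lam k = (\<Prod>j\<in>UNIV. \<xi> j (k j))"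
      and total: "\<And>j. (\<Sum>k\<in>index_set D j. \<xi> j k) = 1"
      and nonneg: "\<And>j k. k \<in> index_set D j \<Longrightarrow> 0 \<le> \<xi> j k"
      using feas by (auto simp: problem_P_def)
    have fin: "finite (index_set D j)" for j
      by (simp add: index_set_def)
    have marginal: "\<xi> j h = (\<Sum>k\<in>{k \<in> multi_index_set D. k j = h}. lam k)"
      if "h \<in> index_set D j" for j h
    proof -
      have "(\<Sum>k\<in>{k \<in> multi_index_set D. k j = h}. lam k)
          = (\<Sum>k\<in>{k \<in> multi_index_set D. k j = h}. \<Prod>i\<in>UNIV. \<xi> i (k i))"
        by (intro sum.cong) (auto simp: lam)
      also have "\<dots> = \<xi> j h"
        unfolding multi_index_set_def
        using that fin total by (intro marginal_of_product_weights) auto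
      finally show ?thesis ..
    qed
    have le_1: "\<xi> j k \<le> 1" if "k \<in> index_set D j" for j k
      using member_le_sum[of k "index_set D j" "\<xi> j"] that nonneg fin total by auto
    have "lam k \<in> {0..1}" if "k \<in> multi_index_set D" for k
    proof -
      have "k j \<in> index_set D j" for j
        using that by (auto simp: multi_index_set_def)
      then show ?thesis
        using that nonneg le_1 by (auto simp: lam intro!: prod_nonneg prod_le_1)
    qed
    then have "lam \<in> multi_index_set D \<rightarrow>\<^sub>E {0..1}"
      using lam_ext by (auto simp: PiE_iff)
    then show ?thesis
      using feas marginal unfolding z problem_P_def problem_Pbar_def
      by (simp only: min_problem.simps mem_Collect_eq case_prod_conv) blast
  qed
  then show ?thesis
    by (simp add: is_relaxation_of_def problem_P_def problem_Pbar_def)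
qed

end
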